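(* Let $\Bbbk$ be a field, $S=\Bbbk[x_1,\ldots,x_n]$, and let $I\subseteq S$ be a monomial ideal with set of minimal monomial generators $\mathcal{G}(I)$. Then the Buchberger complex $\mathfrak{Bu}(I)$ supports a cellular resolution of $I$; that is, the complex $\mathcal{F}_{\mathfrak{Bu}(I)}$ is a free resolution of $I$ over $S$.
   Context: For a finite set $F$ of monomials, $\mathbf{m}_F$ denotes the least common multiple of the elements of $F$ (with $\mathbf{m}_\emptyset=1$). For monomials $u=x_1^{u_1}\cdots x_n^{u_n}$ and $v=x_1^{v_1}\cdots x_n^{v_n}$, $u$ properly divides $v$ (written $u\mid_p v$) if $u$ divides $v$, $u_i<v_i$ for all $i$ with $v_i\neq 0$, and $u_i=v_i$ for all $i$ with $v_i=0$. The Buchberger complex $\mathfrak{Bu}(I)$ is the simplicial complex consisting of all subsets $F\subseteq\mathcal{G}(I)$ such that no $u\in\mathcal{G}(I)$ properly divides $\mathbf{m}_F$. For a simplicial complex $\Delta$ with vertex set $\mathcal{G}(I)$, each face $F$ is labeled by $\mathbf{m}_F$. The complex $\mathcal{F}_\Delta$ is the $\mathbb{N}^n$-graded simplicial chain complex of $\Delta$ homogenized over $S$: it has a free generator $e_F$ in multidegree $\mathbf{m}_F$ and homological degree $|F|-1$ for each nonempty face $F$, with differential $\partial(e_F)=\sum_{v\in F}\pm\frac{\mathbf{m}_F}{\mathbf{m}_{F\setminus\{v\}}}e_{F\setminus\{v\}}$ for $|F|\ge 2$ (signs from the usual simplicial boundary map after fixing an order on the vertices), augmented to $I$ by $e_{\{v\}}\mapsto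 v$. One says that $\Delta$ supports a (cellular) free resolution of $I$ if $\mathcal{F}_\Delta\to I\to 0$ is exact.
   Formalization: The ideal I is assumed proper (I ≠ S): for I = S one has G(I) = {1}, and 1 properly divides 1 vacuously, so the Buchberger complex has no faces and cannot support a resolution of S. *)

theory Defs
  imports Complex_Main "HOL-Library.Poly_Mapping"
begin

section \<open>Monomials and monomial ideals\<close>

text \<open>
  A monomial is identified with its exponent vector, so the product of monomials is the sum
  of exponent vectors and the monomial 1 is the exponent vector 0.  The polynomial ring over
  'k in the variables 'x is the convolution ring of finitely supported functions from
  monomials to 'k; it has finitely many variables when 'x is of class finite.
\<close>

type_synonym 'x mon = "'x \<Rightarrow>\<^sub>0 nat"
type_synonym ('x, 'k) mpol = "('x \<Rightarrow>\<^sub>0 nat) \<Rightarrow>\<^sub>0 'k"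

definition monomial :: "'x mon \<Rightarrow> ('x, 'k::zero_neq_one) mpol" where
  "monomial u = Poly_Mapping.single u 1"

definition mdvd :: "'x mon \<Rightarrow> 'x mon \<Rightarrow> bool" where
  "mdvd u v \<longleftrightarrow> (\<forall>i. Poly_Mapping.lookup u i \<le> Poly_Mapping.lookup v i)"

definition properly_divides :: "'x mon \<Rightarrow> 'x mon \<Rightarrow> bool" where
  "properly_divides u v \<longleftrightarrow> mdvd u v
     \<and> (\<forall>i. Poly_Mapping.lookup v i \<noteq> 0 \<longrightarrow> Poly_Mapping.lookup u i < Poly_Mapping.lookup v i)
     \<and> (\<forall>i. Poly_Mapping.lookup v i = 0 \<longrightarrow> Poly_Mapping.lookup u i = Poly_Mapping.lookup v i)"

text \<open>The least common multiple of a finite set of monomials; it is 1 for the empty set.\<close>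

definition mlcm :: "'x::finite mon set \<Rightarrow> 'x mon" where
  "mlcm F = Abs_poly_mapping (\<lambda>i. Max (insert 0 ((\<lambda>u. Poly_Mapping.lookup u i) ` F)))"

abbreviation ideal_span :: "'r::comm_ring_1 set \<Rightarrow> 'r set" where
  "ideal_span A \<equiv> module.span (*) A"

definition monomial_ideal :: "('x, 'k::comm_ring_1) mpol set \<Rightarrow> bool" where
  "monomial_ideal I \<longleftrightarrow> (\<exists>M. I = ideal_span (monomial ` M))"

definition minimal_generating_set :: "'x mon set \<Rightarrow> ('x, 'k::comm_ring_1) mpol set \<Rightarrow> bool" where
  "minimal_generating_set G I \<longleftrightarrow>
     ideal_span (monomial ` G) = I \<and> (\<forall>H. H \<subset> G \<longrightarrow> ideal_span (monomial ` H) \<noteq> I)"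

text \<open>
  Well-defined for every monomial ideal, see \<open>minimal_generating_set_iff\<close> and
  \<open>min_gens_eq\<close> below.
\<close>

definition min_gens :: "('x, 'k::comm_ring_1) mpol set \<Rightarrow> 'x mon set" where
  "min_gens I = (THE G. minimal_generating_set G I)"


section \<open>Simplicial complexes on the minimal generators\<close>

definition simplicial_complex :: "'v set \<Rightarrow> 'v set set \<Rightarrow> bool" where
  "simplicial_complex V \<Delta> \<longleftrightarrow>
     (\<forall>F\<in>\<Delta>. finite F \<and> F \<subseteq> V) \<and> (\<forall>F\<in>\<Delta>. \<forall>F'. F' \<subseteq> F \<longrightarrow> F' \<in> \<Delta>) \<and> (\<forall>v\<in>V. {v} \<in> \<Delta>)"

text \<open>
  By Dickson's lemma the set of minimal generators is finite, so requiring the faces to be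
  finite is no restriction.
\<close>

definition Buchberger_complex :: "('x::finite, 'k::comm_ring_1) mpol set \<Rightarrow> 'x mon set set" where
  "Buchberger_complex I =
     {F. F \<subseteq> min_gens I \<and> finite F \<and> (\<forall>u\<in>min_gens I. \<not> properly_divides u (mlcm F))}"


section \<open>Free resolutions\<close>

definition linear_map_on ::
    "('r::comm_ring_1 \<Rightarrow> 'm::ab_group_add \<Rightarrow> 'm) \<Rightarrow> ('r \<Rightarrow> 'n::ab_group_add \<Rightarrow> 'n)
      \<Rightarrow> 'm set \<Rightarrow> ('m \<Rightarrow> 'n) \<Rightarrow> bool" where
  "linear_map_on s t M f \<longleftrightarrow>
     (\<forall>x\<in>M. \<forall>y\<in>M. f (x + y) = f x + f y) \<and> (\<forall>c. \<forall>x\<in>M. f (s c x) = t c (f x))"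

definition free_module :: "('r::comm_ring_1 \<Rightarrow> 'm::ab_group_add \<Rightarrow> 'm) \<Rightarrow> 'm set \<Rightarrow> bool" where
  "free_module s M \<longleftrightarrow> (\<exists>B. \<not> module.dependent s B \<and> module.span s B = M)"

text \<open>
  The sequence \<open>\<dots> \<rightarrow> C 2 \<rightarrow> C 1 \<rightarrow> C 0 \<rightarrow> N \<rightarrow> 0\<close> is a free resolution of the module \<open>N\<close>.  The
  differential \<open>d i\<close> goes from \<open>C (Suc i)\<close> to \<open>C i\<close>, the augmentation \<open>\<epsilon>\<close> from \<open>C 0\<close> to \<open>N\<close>.  All
  modules in the complex are submodules of one ambient module with scalar multiplication \<open>s\<close>,
  and \<open>N\<close> lives in a module with scalar multiplication \<open>t\<close>.
\<close>

definition free_resolution ::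
    "('r::comm_ring_1 \<Rightarrow> 'm::ab_group_add \<Rightarrow> 'm) \<Rightarrow> ('r \<Rightarrow> 'n::ab_group_add \<Rightarrow> 'n)
      \<Rightarrow> (nat \<Rightarrow> 'm set) \<Rightarrow> (nat \<Rightarrow> 'm \<Rightarrow> 'm) \<Rightarrow> ('m \<Rightarrow> 'n) \<Rightarrow> 'n set \<Rightarrow> bool" where
  "free_resolution s t C d \<epsilon> N \<longleftrightarrow>
     module s \<and> module t
     \<and> (\<forall>i. free_module s (C i))
     \<and> (\<forall>i. linear_map_on s s (C (Suc i)) (d i))
     \<and> linear_map_on s t (C 0) \<epsilon>
     \<and> \<epsilon> ` C 0 = N
     \<and> d 0 ` C 1 = {x \<in> C 0. \<epsilon> x = 0}
     \<and> (\<forall>i. d (Suc i) ` C (Suc (Suc i)) = {x \<in> C (Suc i). d i x = 0})"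


section \<open>The homogenized chain complex\<close>

text \<open>
  A chain is a finitely supported function from sets of monomials to the polynomial ring;
  the generator \<open>e\<^sub>F\<close> is \<open>Poly_Mapping.single F 1\<close>.
\<close>

type_synonym ('x, 'k) mchain = "'x mon set \<Rightarrow>\<^sub>0 ('x, 'k) mpol"

definition chain_scale ::
    "('x, 'k::comm_ring_1) mpol \<Rightarrow> ('x, 'k) mchain \<Rightarrow> ('x, 'k) mchain" where
  "chain_scale p c = Poly_Mapping.map ((*) p) c"

definition face_chains :: "'x mon set set \<Rightarrow> nat \<Rightarrow> ('x, 'k::comm_ring_1) mchain set" where
  "face_chains \<Delta> i = {c. Poly_Mapping.keys c \<subseteq> {F \<in> \<Delta>. finite F \<and> card F = Suc i}}"

text \<open>
  The vertices are ordered by \<open>r\<close>, and the sign of the facet \<open>F - {v}\<close> of \<open>F\<close> is \<open>(-1)^p\<close>,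
  where \<open>p\<close> is the position of \<open>v\<close> in \<open>F\<close>, counted from 0.  On exponent vectors the quotient
  of two monomials is the difference.
\<close>

definition boundary_gen ::
    "('x::finite mon \<times> 'x mon) set \<Rightarrow> 'x mon set \<Rightarrow> ('x, 'k::comm_ring_1) mchain" where
  "boundary_gen r F =
     (\<Sum>v\<in>F. Poly_Mapping.single (F - {v})
        ((- 1) ^ card {w \<in> F. w \<noteq> v \<and> (w, v) \<in> r} * monomial (mlcm F - mlcm (F - {v}))))"

definition boundary ::
    "('x::finite mon \<times> 'x mon) set \<Rightarrow> ('x, 'k::comm_ring_1) mchain \<Rightarrow> ('x, 'k) mchain" where
  "boundary r c = (\<Sum>F\<in>Poly_Mapping.keys c. chain_scale (Poly_Mapping.lookup c F) (boundary_gen r F))"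

text \<open>Used only on chains of degree 0, which are combinations of singletons.\<close>

definition augmentation :: "('x, 'k::comm_ring_1) mchain \<Rightarrow> ('x, 'k) mpol" where
  "augmentation c = (\<Sum>F\<in>Poly_Mapping.keys c. Poly_Mapping.lookup c F * monomial (the_elem F))"

definition supports_free_resolution ::
    "('x::finite mon \<times> 'x mon) set \<Rightarrow> 'x mon set set \<Rightarrow> ('x, 'k::comm_ring_1) mpol set \<Rightarrow> bool"
  where
  "supports_free_resolution r \<Delta> I \<longleftrightarrow>
     simplicial_complex (min_gens I) \<Delta>
     \<and> free_resolution chain_scale (*) (face_chains \<Delta>) (\<lambda>_. boundary r) augmentation I"


section \<open>Basic facts\<close>

lemma lookup_mlcm: "Poly_Mapping.lookup (mlcm F) i = Max (insert 0 ((\<lambda>u. Poly_Mapping.lookup u i) ` F))"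
  by (simp add: mlcm_def)

lemma mlcm_empty: "mlcm {} = 0"
  by (rule poly_mapping_eqI) (simp add: lookup_mlcm)

lemma mlcm_least:
  assumes "finite F"
  shows "mdvd (mlcm F) m \<longleftrightarrow> (\<forall>u\<in>F. mdvd u m)"
  using assms by (auto simp: mdvd_def lookup_mlcm)

lemma mdvd_refl: "mdvd u u"
  by (simp add: mdvd_def)

lemma mdvd_trans: "mdvd u v \<Longrightarrow> mdvd v w \<Longrightarrow> mdvd u w"
  unfolding mdvd_def by (meson order_trans)

lemma mdvd_antisym: "mdvd u v \<Longrightarrow> mdvd v u \<Longrightarrow> u = v"
  by (rule poly_mapping_eqI) (simp add: mdvd_def le_antisym)

lemma mdvd_add: "mdvd u (w + u)"
  by (simp add: mdvd_def lookup_add)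

lemma mdvd_diff_add: "mdvd u v \<Longrightarrow> (v - u) + u = v"
  by (rule poly_mapping_eqI) (simp add: mdvd_def lookup_add lookup_minus)

lemma monomial_mult: "(monomial (u + v) :: ('x, 'k::comm_ring_1) mpol) = monomial u * monomial v"
  by (simp add: monomial_def mult_single)

lemma module_times: "module ((*) :: 'r::comm_ring_1 \<Rightarrow> 'r \<Rightarrow> 'r)"
  by unfold_locales (simp_all add: algebra_simps)

lemma lookup_chain_scale: "Poly_Mapping.lookup (chain_scale p c) F = p * Poly_Mapping.lookup c F"
  by (cases "Poly_Mapping.lookup c F = 0") (auto simp: chain_scale_def Poly_Mapping.map.rep_eq when_def)

lemma module_chain_scale: "module chain_scale"
  by unfold_locales
    (rule poly_mapping_eqI; simp add: lookup_chain_scale lookup_add algebra_simps)+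

lemma monomial_in_span_iff:
  "(monomial m :: ('x, 'k::comm_ring_1) mpol) \<in> ideal_span (monomial ` M) \<longleftrightarrow> (\<exists>u\<in>M. mdvd u m)"
proof
  interpret module "(*) :: ('x, 'k) mpol \<Rightarrow> ('x, 'k) mpol \<Rightarrow> ('x, 'k) mpol"
    by (rule module_times)
  let ?J = "{p :: ('x, 'k) mpol. \<forall>m\<in>Poly_Mapping.keys p. \<exists>u\<in>M. mdvd u m}"
  have "subspace ?J"
  proof (rule subspaceI)
    fix p q assume "p \<in> ?J" "q \<in> ?J"
    then show "p + q \<in> ?J" using Poly_Mapping.keys_add[of p q] by blast
  next
    fix c q assume q: "q \<in> ?J"
    show "c * q \<in> ?J"
    proof (safe)
      fix m assume "m \<in> Poly_Mapping.keys (c * q)"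
      then obtain a b where "m = a + b" "b \<in> Poly_Mapping.keys q" using Poly_Mapping.keys_mult[of c q] by blast
      then show "\<exists>u\<in>M. mdvd u m" using q mdvd_add mdvd_trans by fastforce
    qed
  qed auto
  moreover have "monomial ` M \<subseteq> ?J"
  proof (safe)
    fix u v assume "u \<in> M" "v \<in> Poly_Mapping.keys (monomial u :: ('x, 'k) mpol)"
    then show "\<exists>u\<in>M. mdvd u v" by (intro bexI[of _ u]) (simp_all add: monomial_def mdvd_refl)
  qed
  ultimately have sub: "span (monomial ` M) \<subseteq> ?J" by (rule span_minimal[rotated])
  assume "(monomial m :: ('x, 'k) mpol) \<in> span (monomial ` M)"
  then have "(monomial m :: ('x, 'k) mpol) \<in> ?J" using sub by blast
  then show "\<exists>u\<in>M. mdvd u m" by (simp add: monomial_def)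
next
  interpret module "(*) :: ('x, 'k) mpol \<Rightarrow> ('x, 'k) mpol \<Rightarrow> ('x, 'k) mpol"
    by (rule module_times)
  assume "\<exists>u\<in>M. mdvd u m"
  then obtain u where u: "u \<in> M" "mdvd u m" by blast
  have "monomial (m - u) * monomial u \<in> span (monomial ` M :: ('x, 'k) mpol set)"
    using u by (intro span_scale span_base) auto
  then show "(monomial m :: ('x, 'k) mpol) \<in> span (monomial ` M)"
    by (simp add: monomial_mult[symmetric] mdvd_diff_add[OF u(2)])
qed

lemma exists_minimal_divisor:
  fixes m :: "'x::finite mon"
  assumes "m \<in> A"
  shows "\<exists>u\<in>A. mdvd u m \<and> (\<forall>v\<in>A. mdvd v u \<longrightarrow> v = u)"
  using assms
proof (induction "\<Sum>i\<in>UNIV. Poly_Mapping.lookup m i" arbitrary: m rule: less_induct)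
  case less
  show ?case
  proof (cases "\<forall>v\<in>A. mdvd v m \<longrightarrow> v = m")
    case True
    then show ?thesis using less.prems mdvd_refl by blast
  next
    case False
    then obtain v where v: "v \<in> A" "mdvd v m" "v \<noteq> m" by blast
    have "\<exists>i. Poly_Mapping.lookup v i \<noteq> Poly_Mapping.lookup m i"
    proof (rule ccontr)
      assume "\<not> ?thesis"
      then have "v = m" by (intro poly_mapping_eqI) simp
      with v(3) show False by contradiction
    qed
    then obtain i where "Poly_Mapping.lookup v i \<noteq> Poly_Mapping.lookup m i" by (elim exE)
    with v(2) have "Poly_Mapping.lookup v i < Poly_Mapping.lookup m i" by (simp add: mdvd_def le_neq_implies_less)
    then have "(\<Sum>i\<in>UNIV. Poly_Mapping.lookup v i) < (\<Sum>i\<in>UNIV. Poly_Mapping.lookup m i)"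
      using v(2) by (intro sum_strict_mono_ex1) (auto simp: mdvd_def)
    from less.hyps[OF this v(1)] show ?thesis using v(2) mdvd_trans by blast
  qed
qed

lemma minimal_iff_least:
  assumes "P L" and "\<And>H. P H \<Longrightarrow> L \<subseteq> H"
  shows "(P G \<and> (\<forall>H. H \<subset> G \<longrightarrow> \<not> P H)) \<longleftrightarrow> G = L"
  using assms by blast

lemma minimal_generating_set_iff:
  fixes I :: "('x::finite, 'k::comm_ring_1) mpol set"
  assumes "monomial_ideal I"
  shows "minimal_generating_set G I \<longleftrightarrow>
    G = {m. monomial m \<in> I \<and> (\<forall>v. monomial v \<in> I \<and> mdvd v m \<longrightarrow> v = m)}" (is "_ \<longleftrightarrow> G = ?G")
proof -
  interpret module "(*) :: ('x, 'k) mpol \<Rightarrow> ('x, 'k) mpol \<Rightarrow> ('x, 'k) mpol"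
    by (rule module_times)
  obtain M where M: "I = span (monomial ` M)" using assms by (auto simp: monomial_ideal_def)
  have gen: "span (monomial ` ?G) = I"
  proof
    have "monomial ` ?G \<subseteq> I" by auto
    then show "span (monomial ` ?G) \<subseteq> I" unfolding M by (rule span_minimal[OF _ subspace_span])
    have "monomial ` M \<subseteq> span (monomial ` ?G :: ('x, 'k) mpol set)"
    proof (safe)
      fix m assume "m \<in> M"
      then have "m \<in> {m. (monomial m :: ('x, 'k) mpol) \<in> I}" unfolding M by (auto intro: span_base)
      from exists_minimal_divisor[OF this]
      have "\<exists>u\<in>?G. mdvd u m" by auto
      then show "(monomial m :: ('x, 'k) mpol) \<in> span (monomial ` ?G)" by (simp only: monomial_in_span_iff)
    qed
    then show "I \<subseteq> span (monomial ` ?G)" unfolding M by (rule span_minimal[OF _ subspace_span])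
  qed
  have least: "?G \<subseteq> H" if H: "span (monomial ` H) = I" for H
  proof
    fix m assume m: "m \<in> ?G"
    then obtain h where h: "h \<in> H" "mdvd h m" using monomial_in_span_iff[of m H] H by auto
    then have "(monomial h :: ('x, 'k) mpol) \<in> I" using H span_base by blast
    then show "m \<in> H" using m h by auto
  qed
  show ?thesis
    unfolding minimal_generating_set_def by (rule minimal_iff_least[where P = "\<lambda>H. span (monomial ` H) = I"]) (fact gen, fact least)
qed

lemma min_gens_eq:
  fixes I :: "('x::finite, 'k::comm_ring_1) mpol set"
  assumes "monomial_ideal I"
  shows "min_gens I = {m. monomial m \<in> I \<and> (\<forall>v. monomial v \<in> I \<and> mdvd v m \<longrightarrow> v = m)}"
  unfolding min_gens_def minimal_generating_set_iff[OF assms] by (rule the_eq_trivial)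

text \<open>
  The differential preserves multidegrees when \<open>e\<^sub>F\<close> has multidegree \<open>mlcm F\<close>.
\<close>

definition homogeneous :: "'x::finite mon \<Rightarrow> ('x, 'k::comm_ring_1) mchain \<Rightarrow> bool" where
  "homogeneous a c \<longleftrightarrow> (\<forall>F\<in>Poly_Mapping.keys c. \<forall>u\<in>Poly_Mapping.keys (Poly_Mapping.lookup c F). u + mlcm F = a)"

lemma homogeneous_add: "homogeneous a c \<Longrightarrow> homogeneous a d \<Longrightarrow> homogeneous a (c + d)"
proof -
  assume c: "homogeneous a c" and d: "homogeneous a d"
  have "u + mlcm F = a"
    if u: "u \<in> Poly_Mapping.keys (Poly_Mapping.lookup (c + d) F)" for F u
  proof -
    have "u \<in> Poly_Mapping.keys (Poly_Mapping.lookup c F)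
        \<or> u \<in> Poly_Mapping.keys (Poly_Mapping.lookup d F)"
      using u Poly_Mapping.keys_add by (fastforce simp: lookup_add)
    moreover have "F \<in> Poly_Mapping.keys e"
      if "u \<in> Poly_Mapping.keys (Poly_Mapping.lookup e F)" for e :: "('a, 'b) mchain"
      using that by (auto simp: in_keys_iff)
    ultimately show ?thesis using c d unfolding homogeneous_def by blast
  qed
  then show ?thesis unfolding homogeneous_def by blast
qed

lemma homogeneous_sum:
  "(\<And>v. v \<in> A \<Longrightarrow> homogeneous a (f v)) \<Longrightarrow> homogeneous a (sum f A)"
  by (induction A rule: infinite_finite_induct) (auto simp: homogeneous_add, auto simp: homogeneous_def)

lemma homogeneous_boundary_gen:
  assumes "finite F"
  shows "homogeneous (mlcm F) (boundary_gen r F :: ('x::finite, 'k::comm_ring_1) mchain)"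
proof -
  have sgn: "(- 1) ^ n * monomial m = (Poly_Mapping.single m ((- 1) ^ n) :: ('x, 'k) mpol)" for n m
    by (induction n) (simp_all add: monomial_def single_uminus)
  have "homogeneous (mlcm F) (Poly_Mapping.single (F - {v})
      ((- 1) ^ n * monomial (mlcm F - mlcm (F - {v}))) :: ('x, 'k) mchain)" if "v \<in> F" for v n
  proof -
    have "mdvd (mlcm (F - {v})) (mlcm F)"
      using mlcm_least[of F "mlcm F"] assms by (auto simp: mlcm_least mdvd_refl)
    then show ?thesis by (auto simp: homogeneous_def sgn mdvd_diff_add split: if_splits)
  qed
  then show ?thesis
    unfolding boundary_gen_def
    by (intro homogeneous_sum)
qed

text \<open>
  Since 1 properly divides 1, the Buchberger complex of the unit ideal has no faces at all and
  does not support a resolution.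
\<close>

lemma Buchberger_complex_UNIV:
  "Buchberger_complex (UNIV :: ('x::finite, 'k::comm_ring_1) mpol set) = {}"
proof -
  have "(UNIV :: ('x, 'k) mpol set) = ideal_span (monomial ` UNIV)" (is "_ = ?J")
  proof -
    interpret module "(*) :: ('x, 'k) mpol \<Rightarrow> ('x, 'k) mpol \<Rightarrow> ('x, 'k) mpol"
      by (rule module_times)
    have "p * monomial 0 \<in> ?J" for p :: "('x, 'k) mpol"
      by (intro span_scale span_base) auto
    then show ?thesis by (auto simp: monomial_def)
  qed
  then have "monomial_ideal (UNIV :: ('x, 'k) mpol set)" by (auto simp: monomial_ideal_def)
  then have G: "min_gens (UNIV :: ('x, 'k) mpol set) = {0}"
  proof -
    have "mdvd 0 m" for m :: "'x mon" by (simp add: mdvd_def)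
    then show ?thesis
      unfolding min_gens_eq[OF \<open>monomial_ideal UNIV\<close>] using mdvd_antisym by fastforce
  qed
  have "properly_divides 0 (mlcm F)" if "F \<subseteq> {0}" for F :: "'x mon set"
  proof -
    have "mlcm F = 0" using that
      by (intro poly_mapping_eqI) (auto simp: lookup_mlcm subset_singleton_iff)
    then show ?thesis by (simp add: properly_divides_def mdvd_def)
  qed
  then show ?thesis by (auto simp: Buchberger_complex_def G)
qed

lemma not_free_resolution_UNIV:
  "\<not> free_resolution chain_scale (*)
      (face_chains (Buchberger_complex (UNIV :: ('x::finite, 'k::comm_ring_1) mpol set)))
      (\<lambda>_. boundary r) augmentation (UNIV :: ('x, 'k) mpol set)"
proof -
  have "augmentation ` face_chains {} 0 = ({0} :: ('x, 'k) mpol set)"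
    by (auto simp: face_chains_def augmentation_def)
  then have "augmentation ` face_chains {} 0 \<noteq> (UNIV :: ('x, 'k) mpol set)"
    using zero_neq_one by (metis UNIV_I singletonD)
  then show ?thesis unfolding free_resolution_def Buchberger_complex_UNIV by blast
qed

end

theory Submission
  imports Defs
begin

text \<open>
  Multiplying the coefficient of each face \<open>F\<close> by the monomial of its label \<open>mlcm F\<close> turns the
  homogenized differential into the usual simplicial boundary, because the monomial factors
  telescope (\<open>lookup_boundary_times_monomial\<close>).  Reading off the coefficient of one monomial \<open>a\<close>
  then splits the complex into its multigraded strands: the strand of degree \<open>a\<close> is the augmented
  simplicial chain complex, over the coefficients, of the faces whose label divides \<open>a\<close>.  These
  faces live on the finite vertex set \<open>V\<close> of generators dividing \<open>a\<close>, so exactness reduces to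
  finite combinatorics, and the fillings found in the finitely many relevant strands are
  reassembled into one homogenized chain (\<open>strand_boundary\<close>, \<open>chain_with_strands\<close>).

  It remains to fill a cycle of one strand inside the Buchberger complex.  In the full simplex on
  \<open>V\<close> this is possible by coning from a vertex (\<open>cone_homotopy\<close>); the filling may however use
  faces whose label \<open>m\<close> is properly divided by some generator \<open>u\<close>.  Such a \<open>u\<close> never attains the
  maximal exponent in any variable that occurs in \<open>m\<close>, hence adding \<open>u\<close> to a face labelled \<open>m\<close>,
  or removing it, leaves the label unchanged: the set of all faces labelled \<open>m\<close> is paired off by
  toggling \<open>u\<close>.  Consequently the part of the filling with label \<open>m\<close> can be pushed, by
  subtracting the boundary of its cone over \<open>u\<close>, onto faces with smaller labels.  Doing this for
  the forbidden labels from the largest downwards leaves a filling in the Buchberger complex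
  (\<open>remove_faces_with_proper_divisors\<close>).

  The augmentation is treated as one more boundary map: the boundary of a combination of vertices
  is its augmentation, placed on the empty face.  Its image is the whole ideal since every
  generator is a vertex of the complex, the ideal being proper and the generators minimal.
\<close>

section \<open>Simplicial chains on a finite ordered vertex set\<close>

definition vertex_sign :: "('v \<times> 'v) set \<Rightarrow> 'v \<Rightarrow> 'v set \<Rightarrow> 'k::comm_ring_1" where
  "vertex_sign r v F = (- 1) ^ card {w \<in> F. w \<noteq> v \<and> (w, v) \<in> r}"

definition chain_on :: "'v set \<Rightarrow> ('v set \<Rightarrow> 'k::comm_ring_1) \<Rightarrow> bool" where
  "chain_on V c \<longleftrightarrow> (\<forall>F. c F \<noteq> 0 \<longrightarrow> F \<subseteq> V)"

text \<open>
  The coefficient formula for the boundary: \<open>F\<close> is a facet of the faces \<open>insert v F\<close> only.  The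
  sign may be computed in \<open>F\<close> since a vertex does not precede itself.
\<close>

definition simplicial_boundary ::
    "('v \<times> 'v) set \<Rightarrow> 'v set \<Rightarrow> ('v set \<Rightarrow> 'k::comm_ring_1) \<Rightarrow> 'v set \<Rightarrow> 'k" where
  "simplicial_boundary r V c F = (\<Sum>v\<in>V - F. vertex_sign r v F * c (insert v F))"

text \<open>
  The coefficient formula for the join with the vertex \<open>w\<close>, which sends a face \<open>E\<close> to
  \<open>insert w E\<close> up to sign, and to zero if \<open>w\<close> already belongs to \<open>E\<close>.
\<close>

definition cone ::
    "('v \<times> 'v) set \<Rightarrow> 'v \<Rightarrow> ('v set \<Rightarrow> 'k::comm_ring_1) \<Rightarrow> 'v set \<Rightarrow> 'k" where
  "cone r w c F = (if w \<in> F then vertex_sign r w F * c (F - {w}) else 0)"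

lemma vertex_sign_square: "vertex_sign r v F * vertex_sign r v F = (1 :: 'k::comm_ring_1)"
  by (simp add: vertex_sign_def flip: power_add mult_2)

lemma vertex_sign_insert_self: "vertex_sign r v (insert v F) = vertex_sign r v F"
  unfolding vertex_sign_def by (rule arg_cong[of _ _ "\<lambda>A. (- 1) ^ card A"]) auto

lemma vertex_sign_insert:
  assumes "finite F" "w \<notin> F" "w \<noteq> v"
  shows "vertex_sign r v (insert w F)
    = (if (w, v) \<in> r then - vertex_sign r v F else (vertex_sign r v F :: 'k::comm_ring_1))"
proof (cases "(w, v) \<in> r")
  case True
  have "{x \<in> insert w F. x \<noteq> v \<and> (x, v) \<in> r} = insert w {x \<in> F. x \<noteq> v \<and> (x, v) \<in> r}"
    using True assms by auto
  then show ?thesis using True assms by (simp add: vertex_sign_def)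
next
  case False
  have "{x \<in> insert w F. x \<noteq> v \<and> (x, v) \<in> r} = {x \<in> F. x \<noteq> v \<and> (x, v) \<in> r}"
    using False by auto
  then show ?thesis using False by (simp add: vertex_sign_def)
qed

lemma simplicial_boundary_nonzero:
  assumes "simplicial_boundary r V c F \<noteq> 0"
  obtains v where "v \<in> V - F" "c (insert v F) \<noteq> 0"
proof -
  from assms obtain v where "v \<in> V - F" "vertex_sign r v F * c (insert v F) \<noteq> 0"
    unfolding simplicial_boundary_def by (rule sum.not_neutral_contains_not_neutral)
  then show thesis using that by fastforce
qed

lemma chain_on_boundary: "chain_on V c \<Longrightarrow> chain_on V (simplicial_boundary r V c)"
  unfolding chain_on_def by (blast elim: simplicial_boundary_nonzero)

lemma cone_nonzero: "cone r w c F \<noteq> 0 \<Longrightarrow> w \<in> F \<and> c (F - {w}) \<noteq> 0"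
  by (auto simp: cone_def split: if_splits)

lemma chain_on_cone: "w \<in> V \<Longrightarrow> chain_on V c \<Longrightarrow> chain_on V (cone r w c)"
  unfolding chain_on_def by (blast dest: cone_nonzero)

lemma simplicial_boundary_diff:
  "simplicial_boundary r V (\<lambda>F. c F - d F) F
    = simplicial_boundary r V c F - simplicial_boundary r V d F"
  by (simp add: simplicial_boundary_def right_diff_distrib sum_subtractf)

lemma simplicial_boundary_zero: "simplicial_boundary r V (\<lambda>_. 0) F = 0"
  by (simp add: simplicial_boundary_def)

locale ordered_vertices =
  fixes V :: "'v set" and r :: "('v \<times> 'v) set"
  assumes finite_V: "finite V" and antisym_r: "antisym r" and total_r: "total_on V r"
begin

text \<open>
  Both identities say that removing two vertices in the two possible orders gives opposite signs:
  exactly one of the vertices precedes the other, so exactly one of the two signs changes when the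
  other vertex is inserted.
\<close>

lemma vertex_sign_insert_two:
  assumes "finite F" "v \<notin> F" "w \<notin> F" "v \<noteq> w" "v \<in> V" "w \<in> V"
  shows vertex_sign_swap: "vertex_sign r v (insert w F) * vertex_sign r w (insert v F)
      = - (vertex_sign r v F * vertex_sign r w F :: 'k::comm_ring_1)"
    and vertex_sign_exchange: "vertex_sign r v F * vertex_sign r w (insert v F)
      = - (vertex_sign r w F * vertex_sign r v (insert w F) :: 'k::comm_ring_1)"
proof -
  have "(v, w) \<in> r \<longleftrightarrow> (w, v) \<notin> r"
    using assms antisym_r total_r by (metis antisymD total_on_def)
  then show "vertex_sign r v (insert w F) * vertex_sign r w (insert v F)
      = - (vertex_sign r v F * vertex_sign r w F :: 'k)"
    and "vertex_sign r v F * vertex_sign r w (insert v F)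
      = - (vertex_sign r w F * vertex_sign r v (insert w F) :: 'k)"
    using assms by (simp_all add: vertex_sign_insert mult.commute)
qed

text \<open>
  The terms of the double sum cancel in pairs.  The pairs are split by the order of their two
  vertices instead of comparing the sum with its own negative, so that characteristic 2 is no
  exception.
\<close>

lemma boundary_boundary:
  fixes c :: "'v set \<Rightarrow> 'k::comm_ring_1"
  assumes "chain_on V c"
  shows "simplicial_boundary r V (simplicial_boundary r V c) F = 0"
proof (cases "F \<subseteq> V")
  case False
  then show ?thesis
    using chain_on_boundary[OF chain_on_boundary[OF assms]] unfolding chain_on_def by blast
next
  case True
  then have fF: "finite F" using finite_V finite_subset by blast
  define f where "f v w = vertex_sign r v F * vertex_sign r w (insert v F) * c (insert w (insert v F))" for v w
  have f_swap: "f v w = - f w v" if "v \<in> V - F" "w \<in> V - F" "v \<noteq> w" for v w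
    using vertex_sign_exchange[OF fF, of v w, where 'k = 'k] that
    by (simp add: f_def insert_commute)
  let ?P = "{(v, w). v \<in> V - F \<and> w \<in> V - F \<and> v \<noteq> w}"
  let ?A = "{(v, w) \<in> ?P. (v, w) \<in> r}" and ?B = "{(v, w) \<in> ?P. (w, v) \<in> r}"
  have "?P \<subseteq> V \<times> V" by auto
  then have fP: "finite ?P" using finite_V finite_subset by blast
  have split: "?P = ?A \<union> ?B" "?A \<inter> ?B = {}"
    using total_r antisym_r by (auto simp: total_on_def dest: antisymD)
  have "simplicial_boundary r V (simplicial_boundary r V c) F
      = (\<Sum>v\<in>V - F. \<Sum>w\<in>V - F - {v}. f v w)"
    unfolding simplicial_boundary_def f_def
    unfolding sum_distrib_left by (intro sum.cong refl) (auto simp: mult.assoc)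
  also have "\<dots> = (\<Sum>(v, w)\<in>(SIGMA v:V - F. V - F - {v}). f v w)"
    using finite_V by (intro sum.Sigma) auto
  also have "(SIGMA v:V - F. V - F - {v}) = ?P" by auto
  also have "(\<Sum>(v, w)\<in>?P. f v w) = (\<Sum>(v, w)\<in>?A. f v w) + (\<Sum>(v, w)\<in>?B. f v w)"
    by (subst split(1), rule sum.union_disjoint)
      (use split(2) in \<open>auto intro: finite_subset[OF _ fP]\<close>)
  also have "(\<Sum>(v, w)\<in>?B. f v w) = (\<Sum>(v, w)\<in>?A. f w v)"
    by (rule sum.reindex_bij_witness[of _ prod.swap prod.swap]) auto
  also have "\<dots> = - (\<Sum>(v, w)\<in>?A. f v w)"
    unfolding sum_negf[symmetric] by (intro sum.cong refl) (auto intro: f_swap)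
  finally show ?thesis by simp
qed

text \<open>
  Coning over a vertex contracts the full simplex.  On a face without \<open>w\<close> the only way to reach it
  from a cone is to delete \<open>w\<close>; on a face with \<open>w\<close> the remaining terms of the two compositions
  cancel, because deleting a vertex and inserting \<open>w\<close> commute up to sign.
\<close>

lemma cone_homotopy:
  fixes c :: "'v set \<Rightarrow> 'k::comm_ring_1"
  assumes c: "chain_on V c" and w: "w \<in> V"
  shows "simplicial_boundary r V (cone r w c) F = c F - cone r w (simplicial_boundary r V c) F"
proof (cases "F \<subseteq> V")
  case False
  then have "simplicial_boundary r V (cone r w c) F = 0" "c F = 0"
      "cone r w (simplicial_boundary r V c) F = 0"
    using c chain_on_boundary[OF chain_on_cone[OF w c], of r]
      chain_on_cone[OF w chain_on_boundary[OF c, of r], of r]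
    unfolding chain_on_def by blast+
  then show ?thesis by simp
next
  case True
  then have fF: "finite F" using finite_V finite_subset by blast
  show ?thesis
  proof (cases "w \<in> F")
    case False
    have "simplicial_boundary r V (cone r w c) F
        = (\<Sum>v\<in>V - F. if v = w then c F else 0)"
      unfolding simplicial_boundary_def
      using False by (intro sum.cong refl)
        (auto simp: cone_def vertex_sign_insert_self vertex_sign_square mult.assoc[symmetric])
    also have "\<dots> = c F" using False w finite_V by simp
    finally show ?thesis using False by (simp add: cone_def)
  next
    case wF: True
    define E where "E = F - {w}"
    have E: "F = insert w E" "w \<notin> E" "finite E" using wF fF by (auto simp: E_def)
    have "cone r w (simplicial_boundary r V c) F
        = (\<Sum>v\<in>V - E. vertex_sign r w E * vertex_sign r v E * c (insert v E))"
      using E by (simp add: cone_def simplicial_boundary_def sum_distrib_left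
          vertex_sign_insert_self mult.assoc)
    also have "V - E = insert w (V - F)" using E w by auto
    also have "(\<Sum>v\<in>insert w (V - F). vertex_sign r w E * vertex_sign r v E * c (insert v E))
        = c F + (\<Sum>v\<in>V - F. vertex_sign r w E * vertex_sign r v E * c (insert v E))"
      using E finite_V by (subst sum.insert) (auto simp: vertex_sign_square)
    also have "(\<Sum>v\<in>V - F. vertex_sign r w E * vertex_sign r v E * c (insert v E))
        = - simplicial_boundary r V (cone r w c) F"
      unfolding simplicial_boundary_def sum_negf[symmetric]
    proof (intro sum.cong refl)
      fix v assume v: "v \<in> V - F"
      then have "vertex_sign r v F * vertex_sign r w (insert v F)
          = - (vertex_sign r v E * vertex_sign r w E :: 'k)"
        using vertex_sign_swap[of E v w, where 'k = 'k] E w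
        by (auto simp: vertex_sign_insert_self insert_commute[of v w])
      moreover have "cone r w c (insert v F) = vertex_sign r w (insert v F) * c (insert v E)"
        using wF v by (auto simp: cone_def E_def insert_Diff_if)
      ultimately show "vertex_sign r w E * vertex_sign r v E * c (insert v E)
          = - (vertex_sign r v F * cone r w c (insert v F))"
        by (simp flip: mult.assoc add: mult.commute[of "vertex_sign r w E"])
    qed
    finally show ?thesis by simp
  qed
qed

end

section \<open>Labels and proper divisibility\<close>

lemma properly_divides_mono: "properly_divides u m \<Longrightarrow> mdvd m m' \<Longrightarrow> properly_divides u m'"
  unfolding properly_divides_def mdvd_def
  by (metis bot_nat_0.extremum_uniqueI bot_nat_0.not_eq_extremum le_less_trans less_le_trans order_trans)

lemma mlcm_mono: "finite F \<Longrightarrow> E \<subseteq> F \<Longrightarrow> mdvd (mlcm E) (mlcm F)"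
  using mlcm_least[of F "mlcm F"] mlcm_least[of E "mlcm F"] finite_subset[of E F]
  by (auto simp: mdvd_refl)

text \<open>
  In a variable occurring in the label, the exponent of \<open>u\<close> is strictly below the maximum, so the
  maximum is attained by another element of \<open>F\<close>.
\<close>

lemma mlcm_remove_proper_divisor:
  assumes "finite F" "properly_divides u (mlcm F)"
  shows "mlcm (F - {u}) = mlcm F"
proof (rule mdvd_antisym)
  show "mdvd (mlcm (F - {u})) (mlcm F)" using assms(1) by (intro mlcm_mono) auto
  show "mdvd (mlcm F) (mlcm (F - {u}))"
    unfolding mdvd_def
  proof
    fix i
    show "Poly_Mapping.lookup (mlcm F) i \<le> Poly_Mapping.lookup (mlcm (F - {u})) i"
    proof (cases "Poly_Mapping.lookup (mlcm F) i = 0")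
      case False
      have "Poly_Mapping.lookup (mlcm F) i \<in> insert 0 ((\<lambda>u. Poly_Mapping.lookup u i) ` F)"
        unfolding lookup_mlcm using assms(1) by (intro Max_in) auto
      then obtain v where v: "v \<in> F" "Poly_Mapping.lookup v i = Poly_Mapping.lookup (mlcm F) i" using False by auto
      have "Poly_Mapping.lookup u i < Poly_Mapping.lookup (mlcm F) i"
        using assms(2) False by (simp add: properly_divides_def)
      with v have "v \<in> F - {u}" by auto
      then have "Poly_Mapping.lookup v i \<le> Poly_Mapping.lookup (mlcm (F - {u})) i"
        unfolding lookup_mlcm using assms(1) by (intro Max_ge) auto
      then show ?thesis using v by simp
    qed simp
  qed
qed

section \<open>Acyclicity of the strands\<close>

definition has_proper_divisor :: "'x mon set \<Rightarrow> 'x mon \<Rightarrow> bool" where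
  "has_proper_divisor V m \<longleftrightarrow> (\<exists>u\<in>V. properly_divides u m)"

text \<open>
  The set \<open>U\<close> holds the forbidden labels that the chain \<open>c\<close> may still use.  It is downward closed
  among the forbidden labels, because clearing one label may create faces with any smaller ones.
  A maximal element \<open>m\<close> of \<open>U\<close> is cleared as follows.  Forbidden labels are closed under multiples,
  so no face of \<open>c\<close> has a label that is a strict multiple of \<open>m\<close>, and the part \<open>cm\<close> of \<open>c\<close> with label \<open>m\<close> is a
  cycle as far as faces with label \<open>m\<close> are concerned.  By \<open>cone_homotopy\<close>, subtracting the boundary
  of the cone over a proper divisor \<open>w\<close> of \<open>m\<close> replaces \<open>cm\<close> by the cone over its boundary,
  which consists of faces whose labels divide \<open>m\<close> and differ from \<open>m\<close>.
\<close>

lemma remove_faces_with_proper_divisors: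
  fixes c :: "'x::finite mon set \<Rightarrow> 'k::comm_ring_1"
  assumes "ordered_vertices V r"
    and "finite U" "\<And>m. m \<in> U \<Longrightarrow> has_proper_divisor V m"
    and "\<And>m F. m \<in> U \<Longrightarrow> F \<subseteq> V \<Longrightarrow> has_proper_divisor V (mlcm F) \<Longrightarrow> mdvd (mlcm F) m \<Longrightarrow> mlcm F \<in> U"
    and "chain_on V c" "\<And>F. c F \<noteq> 0 \<Longrightarrow> has_proper_divisor V (mlcm F) \<Longrightarrow> mlcm F \<in> U"
    and "\<And>F. simplicial_boundary r V c F \<noteq> 0 \<Longrightarrow> \<not> has_proper_divisor V (mlcm F)"
  shows "\<exists>d. chain_on V d \<and> (\<forall>F. d F \<noteq> 0 \<longrightarrow> \<not> has_proper_divisor V (mlcm F))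
    \<and> simplicial_boundary r V d = simplicial_boundary r V c"
  using assms(2-)
proof (induction U arbitrary: c rule: finite_psubset_induct)
  case (psubset U)
  interpret ordered_vertices V r by fact
  note bad_U = psubset.prems(1) and down_U = psubset.prems(2) and c = psubset.prems(3)
    and c_U = psubset.prems(4) and bdry_c = psubset.prems(5)
  show ?case
  proof (cases "U = {}")
    case True
    then show ?thesis using c c_U by blast
  next
    case False
    obtain m where m: "m \<in> U" and max: "\<And>m'. m' \<in> U \<Longrightarrow> mdvd m m' \<Longrightarrow> m' = m"
    proof -
      have "\<exists>m\<in>U. \<forall>m'\<in>U. m' \<noteq> m \<longrightarrow> \<not> (mdvd m m' \<and> m \<noteq> m')"
        using psubset.hyps False
        by (intro Finite_Set.bex_max_element)
          (auto simp: asymp_on_def transp_on_def dest: mdvd_antisym intro: mdvd_trans)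
      then show thesis using that by blast
    qed
    obtain w where w: "w \<in> V" "properly_divides w m"
      using bad_U[OF m] by (auto simp: has_proper_divisor_def)
    define cm where "cm F = (if mlcm F = m then c F else 0)" for F
    have cm: "chain_on V cm" using c by (auto simp: chain_on_def cm_def)
    define e where "e = cone r w cm"
    have e: "chain_on V e" unfolding e_def by (rule chain_on_cone[OF w(1) cm])
    define d where "d F = c F - simplicial_boundary r V e F" for F
    have d_eq: "d F = c F - cm F + cone r w (simplicial_boundary r V cm) F" for F
      unfolding d_def e_def using cone_homotopy[OF cm w(1)] by simp
    have d: "chain_on V d"
      using c chain_on_boundary[OF e, of r] by (force simp: chain_on_def d_def)
    have bdry_d: "simplicial_boundary r V d = simplicial_boundary r V c"
      using simplicial_boundary_diff[of r V c "simplicial_boundary r V e"] boundary_boundary[OF e]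
      by (auto simp: d_def[abs_def])
    have fin: "finite F" if "F \<subseteq> V" for F using that finite_V finite_subset by blast
    \<comment> \<open>Every coface of a face labelled \<open>m\<close> that occurs in \<open>c\<close> has label \<open>m\<close> itself, by maximality.\<close>
    have bdry_cm: "simplicial_boundary r V cm F = 0" if F: "mlcm F = m" for F
    proof -
      have "cm (insert v F) = c (insert v F)" for v
      proof (cases "c (insert v F) = 0")
        case False
        then have "insert v F \<subseteq> V" using c unfolding chain_on_def by blast
        then have "mdvd m (mlcm (insert v F))"
          using F fin mlcm_mono[of "insert v F" F] by auto
        moreover from this have "has_proper_divisor V (mlcm (insert v F))"
          using w properly_divides_mono by (auto simp: has_proper_divisor_def)
        ultimately have "mlcm (insert v F) = m" using max c_U[OF False] by blast
        then show ?thesis by (simp add: cm_def)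
      qed (simp add: cm_def)
      then have "simplicial_boundary r V cm F = simplicial_boundary r V c F"
        by (simp add: simplicial_boundary_def)
      also have "\<dots> = 0" using bdry_c bad_U[OF m] F by blast
      finally show ?thesis .
    qed
    have d_U: "mlcm F \<in> U - {m}" if dF: "d F \<noteq> 0" and bad: "has_proper_divisor V (mlcm F)" for F
    proof (cases "cone r w (simplicial_boundary r V cm) F = 0")
      case True
      then have "c F \<noteq> 0" "mlcm F \<noteq> m" using dF by (auto simp: d_eq cm_def split: if_splits)
      then show ?thesis using c_U bad by blast
    next
      case False
      then have wF: "w \<in> F" and nz: "simplicial_boundary r V cm (F - {w}) \<noteq> 0"
        using cone_nonzero[OF False] by simp_all
      have FV: "F \<subseteq> V" using d dF by (auto simp: chain_on_def)
      obtain v where v: "cm (insert v (F - {w})) \<noteq> 0"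
        using nz by (rule simplicial_boundary_nonzero)
      then have "mlcm (insert v (F - {w})) = m" "insert v (F - {w}) \<subseteq> V"
        using cm by (auto simp: cm_def chain_on_def split: if_splits)
      then have "mdvd (mlcm (F - {w})) m" using mlcm_mono[OF fin, of "insert v (F - {w})" "F - {w}"] by auto
      moreover have "mdvd w m" using w(2) by (simp add: properly_divides_def)
      ultimately have "mdvd (mlcm F) m" using fin[OF FV] by (auto simp: mlcm_least)
      \<comment> \<open>Otherwise \<open>F - {w}\<close> would have label \<open>m\<close> too, where the boundary of \<open>cm\<close> vanishes.\<close>
      moreover have "mlcm F \<noteq> m"
        using bdry_cm[of "F - {w}"] nz mlcm_remove_proper_divisor[OF fin[OF FV], of w] w(2) by auto
      ultimately show ?thesis using down_U[OF m FV bad] by blast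
    qed
    have "\<exists>d'. chain_on V d' \<and> (\<forall>F. d' F \<noteq> 0 \<longrightarrow> \<not> has_proper_divisor V (mlcm F))
        \<and> simplicial_boundary r V d' = simplicial_boundary r V d"
    proof (rule psubset.IH)
      show "U - {m} \<subset> U" using m by blast
      show "has_proper_divisor V m'" if "m' \<in> U - {m}" for m' using that bad_U by blast
      show "mlcm F \<in> U - {m}"
        if m': "m' \<in> U - {m}" and F: "F \<subseteq> V" "has_proper_divisor V (mlcm F)" "mdvd (mlcm F) m'" for m' F
        using down_U[of m' F] max[of m'] m' F by auto
      show "chain_on V d" by (rule d)
      show "mlcm F \<in> U - {m}" if "d F \<noteq> 0" "has_proper_divisor V (mlcm F)" for F
        using that by (rule d_U)
      show "\<not> has_proper_divisor V (mlcm F)" if "simplicial_boundary r V d F \<noteq> 0" for F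
        using that bdry_c by (simp add: bdry_d)
    qed
    then show ?thesis by (simp add: bdry_d)
  qed
qed

text \<open>
  The cone over a vertex is a first filling, which is then moved off the forbidden labels.  Only
  the part of the result on faces with \<open>Suc n\<close> vertices is kept: the boundary map lowers the
  cardinality by one, so this part alone accounts for the boundary \<open>z\<close>.
\<close>

lemma cycle_is_boundary_without_proper_divisors:
  fixes z :: "'x::finite mon set \<Rightarrow> 'k::comm_ring_1"
  assumes V: "ordered_vertices V r" "V \<noteq> {}"
    and z: "chain_on V z" "\<And>F. z F \<noteq> 0 \<Longrightarrow> card F = n"
      "\<And>F. z F \<noteq> 0 \<Longrightarrow> \<not> has_proper_divisor V (mlcm F)"
      "\<And>F. simplicial_boundary r V z F = 0"
  shows "\<exists>d. (\<forall>F. d F \<noteq> 0 \<longrightarrow> F \<subseteq> V \<and> card F = Suc n \<and> \<not> has_proper_divisor V (mlcm F))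
    \<and> simplicial_boundary r V d = z"
proof -
  interpret ordered_vertices V r by fact
  obtain w where w: "w \<in> V" using V by blast
  have fill: "simplicial_boundary r V (cone r w z) = z"
    using cone_homotopy[OF z(1) w] z(4) by (auto simp: cone_def)
  let ?U = "{m \<in> mlcm ` Pow V. has_proper_divisor V m}"
  have "\<exists>d. chain_on V d \<and> (\<forall>F. d F \<noteq> 0 \<longrightarrow> \<not> has_proper_divisor V (mlcm F))
      \<and> simplicial_boundary r V d = simplicial_boundary r V (cone r w z)"
  proof (rule remove_faces_with_proper_divisors[OF V(1), of ?U])
    show "finite ?U" using finite_V by simp
    show "chain_on V (cone r w z)" by (rule chain_on_cone[OF w z(1)])
    then show "mlcm F \<in> ?U" if "cone r w z F \<noteq> 0" "has_proper_divisor V (mlcm F)" for F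
      using that by (auto simp: chain_on_def)
    show "\<not> has_proper_divisor V (mlcm F)"
      if "simplicial_boundary r V (cone r w z) F \<noteq> 0" for F
      using that z(3) by (simp add: fill)
  qed auto
  then obtain d where d: "chain_on V d" "\<And>F. d F \<noteq> 0 \<Longrightarrow> \<not> has_proper_divisor V (mlcm F)"
      "simplicial_boundary r V d = z"
    by (auto simp: fill)
  define d' where "d' F = (if card F = Suc n then d F else 0)" for F
  have "simplicial_boundary r V d' F = z F" for F
  proof (cases "F \<subseteq> V")
    case True
    then have "finite F" using finite_V finite_subset by blast
    then have "simplicial_boundary r V d' F = (if card F = n then simplicial_boundary r V d F else 0)"
      by (auto simp: simplicial_boundary_def d'_def intro!: sum.cong sum.neutral)
    then show ?thesis using z(2) d(3) by auto
  next
    case False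
    have "chain_on V d'" using d(1) by (auto simp: chain_on_def d'_def)
    then show ?thesis using chain_on_boundary[of V d' r] z(1) False by (metis chain_on_def)
  qed
  then show ?thesis using d by (intro exI[of _ d']) (auto simp: d'_def chain_on_def split: if_splits)
qed

section \<open>Strands of homogenized chains\<close>

lemma poly_mapping_sum_single:
  "c = (\<Sum>x\<in>Poly_Mapping.keys c. Poly_Mapping.single x (Poly_Mapping.lookup c x))"
  by (rule poly_mapping_eqI) (simp add: lookup_sum lookup_single when_def in_keys_iff)

lemma mdvd_iff_add: "b + u = a \<longleftrightarrow> mdvd u a \<and> b = a - u"
  by (metis add_diff_cancel_right' mdvd_add mdvd_diff_add)

lemma lookup_times_monomial:
  fixes p :: "('x, 'k::comm_ring_1) mpol"
  shows "Poly_Mapping.lookup (p * monomial u) a = (if mdvd u a then Poly_Mapping.lookup p (a - u) else 0)"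
proof -
  have "p * monomial u
      = (\<Sum>b\<in>Poly_Mapping.keys p. Poly_Mapping.single (b + u) (Poly_Mapping.lookup p b))"
    using arg_cong[OF poly_mapping_sum_single[of p], of "\<lambda>q. q * monomial u"]
    by (simp add: sum_distrib_right monomial_def mult_single)
  then show ?thesis
    by (auto simp: lookup_sum lookup_single when_def mdvd_iff_add in_keys_iff)
qed

text \<open>
  The multiplication by the label makes the coefficients of all faces live in the same multidegree,
  so that one monomial \<open>a\<close> can be read off everywhere.
\<close>

definition strand :: "'x::finite mon \<Rightarrow> ('x, 'k::comm_ring_1) mchain \<Rightarrow> 'x mon set \<Rightarrow> 'k" where
  "strand a c F = Poly_Mapping.lookup (Poly_Mapping.lookup c F * monomial (mlcm F)) a"

lemma strand_eq:
  "strand a c F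
    = (if mdvd (mlcm F) a then Poly_Mapping.lookup (Poly_Mapping.lookup c F) (a - mlcm F) else 0)"
  by (simp add: strand_def lookup_times_monomial)

lemma strand_zero: "strand a 0 F = 0"
  by (simp add: strand_def)

lemma strand_shift: "strand (b + mlcm F) c F = Poly_Mapping.lookup (Poly_Mapping.lookup c F) b"
  by (simp add: strand_eq mdvd_add)

lemma strand_eqI:
  assumes "\<And>a F. strand a c F = strand a d F"
  shows "c = d"
  by (intro poly_mapping_eqI) (use assms in \<open>simp flip: strand_shift\<close>)

lemma keys_iff_strand: "F \<in> Poly_Mapping.keys c \<longleftrightarrow> (\<exists>a. strand a c F \<noteq> 0)"
proof
  assume "F \<in> Poly_Mapping.keys c"
  then have "Poly_Mapping.lookup c F \<noteq> 0" by (simp add: in_keys_iff)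
  then obtain b where "Poly_Mapping.lookup (Poly_Mapping.lookup c F) b \<noteq> 0"
    by (metis poly_mapping_eqI lookup_zero)
  then show "\<exists>a. strand a c F \<noteq> 0" by (auto simp flip: strand_shift)
next
  assume "\<exists>a. strand a c F \<noteq> 0"
  then show "F \<in> Poly_Mapping.keys c" by (auto simp: strand_eq in_keys_iff split: if_splits)
qed

lemma strand_sum: "strand a (sum f A) F = (\<Sum>x\<in>A. strand a (f x) F)"
  by (simp add: strand_def lookup_sum sum_distrib_right)

lemma strand_single_single:
  "strand a (Poly_Mapping.single E (Poly_Mapping.single b x)) F
    = (if F = E \<and> a = b + mlcm E then x else 0)"
proof -
  have "a = b + mlcm E \<longleftrightarrow> mdvd (mlcm E) a \<and> b = a - mlcm E" using mdvd_iff_add by metis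
  then show ?thesis by (auto simp: strand_eq lookup_single when_def)
qed

lemma finite_strand_degrees: "finite {a. \<exists>F. strand a c F \<noteq> 0}"
proof (rule finite_subset)
  show "{a. \<exists>F. strand a c F \<noteq> 0}
      \<subseteq> (\<Union>F\<in>Poly_Mapping.keys c. Poly_Mapping.keys (Poly_Mapping.lookup c F * monomial (mlcm F)))"
  proof
    fix a assume "a \<in> {a. \<exists>F. strand a c F \<noteq> 0}"
    then obtain F where F: "strand a c F \<noteq> 0" by blast
    then have "F \<in> Poly_Mapping.keys c" using keys_iff_strand by blast
    moreover have "a \<in> Poly_Mapping.keys (Poly_Mapping.lookup c F * monomial (mlcm F))"
      using F by (simp add: strand_def in_keys_iff)
    ultimately show "a \<in> (\<Union>F\<in>Poly_Mapping.keys c.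
        Poly_Mapping.keys (Poly_Mapping.lookup c F * monomial (mlcm F)))" by blast
  qed
qed simp

text \<open>
  A coefficient in degree \<open>a\<close> can be placed on \<open>F\<close> exactly when the label of \<open>F\<close> divides \<open>a\<close>; this
  is the only obstruction to prescribing strands.
\<close>

lemma chain_with_strands:
  fixes \<delta> :: "'x::finite mon \<Rightarrow> 'x mon set \<Rightarrow> 'k::comm_ring_1"
  assumes "finite A" and fin: "\<And>a. a \<in> A \<Longrightarrow> finite {F. \<delta> a F \<noteq> 0}"
    and dvd: "\<And>a F. a \<in> A \<Longrightarrow> \<delta> a F \<noteq> 0 \<Longrightarrow> mdvd (mlcm F) a"
  obtains d :: "('x, 'k) mchain" where "\<And>a F. strand a d F = (if a \<in> A then \<delta> a F else 0)"
proof
  let ?d = "\<Sum>a\<in>A. \<Sum>F | \<delta> a F \<noteq> 0. Poly_Mapping.single F (Poly_Mapping.single (a - mlcm F) (\<delta> a F))"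
  fix a F
  have "strand a ?d F = (\<Sum>b\<in>A. \<Sum>E | \<delta> b E \<noteq> 0. if F = E \<and> a = b then \<delta> b E else 0)"
    unfolding strand_sum strand_single_single
    by (intro sum.cong refl if_cong) (auto simp: mdvd_diff_add dvd)
  also have "\<dots> = (\<Sum>b\<in>A. if a = b then \<delta> b F else 0)"
  proof (intro sum.cong refl)
    fix b assume "b \<in> A"
    have "(\<Sum>E | \<delta> b E \<noteq> 0. if F = E \<and> a = b then \<delta> b E else 0)
        = (\<Sum>E | \<delta> b E \<noteq> 0. if F = E then (if a = b then \<delta> b E else 0) else 0)"
      by (intro sum.cong) auto
    also have "\<dots> = (if a = b then \<delta> b F else 0)"
      using fin[OF \<open>b \<in> A\<close>] by simp
    finally show "(\<Sum>E | \<delta> b E \<noteq> 0. if F = E \<and> a = b then \<delta> b E else 0) = (if a = b then \<delta> b F else 0)" .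
  qed
  also have "\<dots> = (if a \<in> A then \<delta> a F else 0)" using \<open>finite A\<close> by simp
  finally show "strand a ?d F = (if a \<in> A then \<delta> a F else 0)" .
qed

lemma finite_divisors:
  fixes a :: "'x::finite mon"
  shows "finite {u. mdvd u a}"
proof (rule finite_imageD)
  let ?B = "{..Max (range (Poly_Mapping.lookup a))}"
  have "Poly_Mapping.lookup u i \<in> ?B" if "mdvd u a" for u :: "'x mon" and i
    using that Max_ge[of "range (Poly_Mapping.lookup a)" "Poly_Mapping.lookup a i"]
    by (auto simp: mdvd_def intro: order_trans)
  then have "Poly_Mapping.lookup ` {u. mdvd u a}
      \<subseteq> {f. \<forall>x. (x \<in> UNIV \<longrightarrow> f x \<in> ?B) \<and> (x \<notin> UNIV \<longrightarrow> f x = 0)}" by auto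
  then show "finite (Poly_Mapping.lookup ` {u. mdvd u a})"
    by (rule finite_subset) (rule finite_set_of_finite_funs; simp)
  show "inj_on Poly_Mapping.lookup {u. mdvd u a}" by (simp add: inj_on_def lookup_inject)
qed

text \<open>
  Dehomogenization: the quotient of the labels of \<open>E\<close> and \<open>F\<close> in the differential, times the label
  of \<open>F\<close>, is the label of \<open>E\<close>.  Only the signs of the simplicial boundary remain.
\<close>

lemma lookup_boundary_times_monomial:
  fixes c :: "('x::finite, 'k::comm_ring_1) mchain"
  assumes fin: "\<forall>F\<in>Poly_Mapping.keys c. finite F"
  shows "Poly_Mapping.lookup (boundary r c) F * monomial (mlcm F)
    = (\<Sum>v | v \<notin> F \<and> insert v F \<in> Poly_Mapping.keys c.
        vertex_sign r v F * (Poly_Mapping.lookup c (insert v F) * monomial (mlcm (insert v F))))"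
proof -
  let ?K = "Poly_Mapping.keys c"
  let ?g = "\<lambda>E. Poly_Mapping.lookup c E * monomial (mlcm E)"
  let ?T = "SIGMA E:?K. {v \<in> E. E - {v} = F}"
  have "Poly_Mapping.lookup (boundary r c) F * monomial (mlcm F)
      = (\<Sum>E\<in>?K. Poly_Mapping.lookup c E * Poly_Mapping.lookup (boundary_gen r E) F * monomial (mlcm F))"
    by (simp add: boundary_def lookup_sum lookup_chain_scale sum_distrib_right)
  also have "\<dots> = (\<Sum>E\<in>?K. \<Sum>v\<in>{v \<in> E. E - {v} = F}. vertex_sign r v F * ?g E)"
  proof (intro sum.cong refl)
    fix E assume "E \<in> ?K"
    then have E: "finite E" using fin by blast
    have "Poly_Mapping.lookup c E * Poly_Mapping.lookup (boundary_gen r E) F * monomial (mlcm F)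
        = (\<Sum>v\<in>E. if E - {v} = F then Poly_Mapping.lookup c E
            * (vertex_sign r v E * monomial (mlcm E - mlcm F)) * monomial (mlcm F) else 0)"
      unfolding boundary_gen_def lookup_sum sum_distrib_left sum_distrib_right
      by (intro sum.cong refl) (auto simp: lookup_single when_def vertex_sign_def)
    also have "\<dots> = (\<Sum>v\<in>{v \<in> E. E - {v} = F}. Poly_Mapping.lookup c E
            * (vertex_sign r v E * monomial (mlcm E - mlcm F)) * monomial (mlcm F))"
      using E by (intro sum.inter_filter[symmetric])
    also have "\<dots> = (\<Sum>v\<in>{v \<in> E. E - {v} = F}. vertex_sign r v F * ?g E)"
    proof (intro sum.cong refl)
      fix v assume v: "v \<in> {v \<in> E. E - {v} = F}"
      then have "mdvd (mlcm F) (mlcm E)" using E by (intro mlcm_mono) auto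
      then have "monomial (mlcm E) = (monomial (mlcm E - mlcm F) * monomial (mlcm F) :: ('x, 'k) mpol)"
        by (simp add: mdvd_diff_add flip: monomial_mult)
      moreover have "vertex_sign r v E = (vertex_sign r v F :: ('x, 'k) mpol)"
        using vertex_sign_insert_self[of r v F] v by (auto simp: insert_absorb)
      ultimately show "Poly_Mapping.lookup c E
            * (vertex_sign r v E * monomial (mlcm E - mlcm F)) * monomial (mlcm F)
          = vertex_sign r v F * ?g E"
        by (simp add: mult.assoc mult.left_commute)
    qed
    finally show "Poly_Mapping.lookup c E * Poly_Mapping.lookup (boundary_gen r E) F * monomial (mlcm F)
        = (\<Sum>v\<in>{v \<in> E. E - {v} = F}. vertex_sign r v F * ?g E)" .
  qed
  also have "\<dots> = (\<Sum>(E, v)\<in>?T. vertex_sign r v F * ?g E)"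
    using fin by (intro sum.Sigma) auto
  also have "\<dots> = (\<Sum>v | v \<notin> F \<and> insert v F \<in> ?K. vertex_sign r v F * ?g (insert v F))"
    by (rule sum.reindex_bij_witness[of _ "\<lambda>v. (insert v F, v)" snd]) (auto simp: insert_absorb)
  finally show ?thesis .
qed

text \<open>
  Any finite vertex set supporting the strand gives the same boundary, so the vertex set may be
  chosen depending on \<open>a\<close>, for instance as a set of divisors of \<open>a\<close>.
\<close>

lemma strand_boundary:
  fixes c :: "('x::finite, 'k::comm_ring_1) mchain"
  assumes fin: "\<forall>F\<in>Poly_Mapping.keys c. finite F"
    and V: "finite V" "chain_on V (strand a c)"
  shows "strand a (boundary r c) = simplicial_boundary r V (strand a c)"
proof
  fix F
  let ?T = "{v. v \<notin> F \<and> insert v F \<in> Poly_Mapping.keys c}"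
  have "?T \<subseteq> \<Union>(Poly_Mapping.keys c)" by auto
  then have fT: "finite ?T" by (rule finite_subset) (use fin in auto)
  have sign: "Poly_Mapping.lookup (vertex_sign r v F * p) a = vertex_sign r v F * Poly_Mapping.lookup p a"
    for v and p :: "('x, 'k) mpol"
    by (simp add: vertex_sign_def minus_one_power_iff)
  have "strand a (boundary r c) F = (\<Sum>v\<in>?T. vertex_sign r v F * strand a c (insert v F))"
    unfolding strand_def lookup_boundary_times_monomial[OF fin] lookup_sum sign ..
  also have "\<dots> = (\<Sum>v\<in>V - F. vertex_sign r v F * strand a c (insert v F))"
  proof (rule sum.mono_neutral_cong)
    show "vertex_sign r v F * strand a c (insert v F) = 0" if "v \<in> V - F - ?T" for v
      using that keys_iff_strand[of "insert v F" c] by auto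
    show "vertex_sign r v F * strand a c (insert v F) = 0" if "v \<in> ?T - (V - F)" for v
    proof -
      have "\<not> insert v F \<subseteq> V" using that by auto
      then have "strand a c (insert v F) = 0" using V(2) unfolding chain_on_def by blast
      then show ?thesis by simp
    qed
  qed (use fT V in auto)
  finally show "strand a (boundary r c) F = simplicial_boundary r V (strand a c) F"
    by (simp add: simplicial_boundary_def)
qed

lemma keys_boundary:
  assumes fin: "\<forall>F\<in>Poly_Mapping.keys c. finite F" and F: "F \<in> Poly_Mapping.keys (boundary r c)"
  obtains v where "v \<notin> F" "insert v F \<in> Poly_Mapping.keys c"
proof -
  let ?V = "\<Union>(Poly_Mapping.keys c)"
  obtain a where a: "strand a (boundary r c) F \<noteq> 0" using F by (auto simp: keys_iff_strand)
  have "finite ?V" using fin by auto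
  moreover have "chain_on ?V (strand a c)"
    unfolding chain_on_def using keys_iff_strand by blast
  ultimately have "strand a (boundary r c) = simplicial_boundary r ?V (strand a c)"
    by (rule strand_boundary[OF fin])
  then show thesis using a that keys_iff_strand by (auto elim!: simplicial_boundary_nonzero)
qed

section \<open>Exactness\<close>

abbreviation divisors_in :: "'x mon set \<Rightarrow> 'x mon \<Rightarrow> 'x mon set" where
  "divisors_in G a \<equiv> {u \<in> G. mdvd u a}"

lemma chain_on_strand:
  assumes "\<forall>F\<in>Poly_Mapping.keys c. finite F \<and> F \<subseteq> G"
  shows "chain_on (divisors_in G a) (strand a c)"
  unfolding chain_on_def
proof (intro allI impI)
  fix F assume nz: "strand a c F \<noteq> 0"
  then have "finite F" "F \<subseteq> G" using assms keys_iff_strand by blast+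
  moreover have "mdvd (mlcm F) a" using nz by (auto simp: strand_eq split: if_splits)
  ultimately show "F \<subseteq> divisors_in G a" by (auto simp: mlcm_least)
qed

lemma ordered_vertices_divisors:
  fixes G :: "'x::finite mon set"
  assumes "linear_order_on G r"
  shows "ordered_vertices (divisors_in G a) r"
proof
  show "finite (divisors_in G a)" using finite_divisors[of a] by (rule rev_finite_subset) auto
  show "antisym r" "total_on (divisors_in G a) r"
    using assms by (auto simp: linear_order_on_def partial_order_on_def total_on_def)
qed

lemma boundary_boundary_chain:
  fixes c :: "('x::finite, 'k::comm_ring_1) mchain"
  assumes r: "linear_order_on G r"
    and c: "\<forall>F\<in>Poly_Mapping.keys c. finite F \<and> F \<subseteq> G"
  shows "boundary r (boundary r c) = 0"
proof (rule strand_eqI)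
  fix a F
  interpret ordered_vertices "divisors_in G a" r by (rule ordered_vertices_divisors[OF r])
  have bc: "\<forall>F\<in>Poly_Mapping.keys (boundary r c). finite F \<and> F \<subseteq> G"
  proof
    fix F assume F: "F \<in> Poly_Mapping.keys (boundary r c)"
    have "\<forall>F\<in>Poly_Mapping.keys c. finite F" using c by blast
    from this F obtain v where "insert v F \<in> Poly_Mapping.keys c" by (rule keys_boundary)
    then show "finite F \<and> F \<subseteq> G" using c by auto
  qed
  have "strand a (boundary r (boundary r c)) F
      = simplicial_boundary r (divisors_in G a) (strand a (boundary r c)) F"
    using bc by (subst strand_boundary[OF _ finite_V chain_on_strand[OF bc]]) auto
  also have "strand a (boundary r c) = simplicial_boundary r (divisors_in G a) (strand a c)"
    using c by (intro strand_boundary[OF _ finite_V chain_on_strand[OF c]]) auto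
  also have "simplicial_boundary r (divisors_in G a) (simplicial_boundary r (divisors_in G a) (strand a c)) F = 0"
    by (rule boundary_boundary[OF chain_on_strand[OF c]])
  finally show "strand a (boundary r (boundary r c)) F = strand a 0 F" by (simp add: strand_zero)
qed

definition Buchberger_faces :: "'x::finite mon set \<Rightarrow> 'x mon set set" where
  "Buchberger_faces G = {F. F \<subseteq> G \<and> finite F \<and> (\<forall>u\<in>G. \<not> properly_divides u (mlcm F))}"

text \<open>
  Each nonzero strand of the cycle is filled separately.  It contains a nonempty face, so some
  generator divides \<open>a\<close> and there is a vertex to cone from.  A proper divisor of the label of a face
  of the strand also divides \<open>a\<close>, hence it does not matter whether proper divisors are sought among
  all generators or among the vertices of the strand.
\<close>

lemma cycle_is_boundary:
  fixes c :: "('x::finite, 'k::comm_ring_1) mchain"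
  assumes r: "linear_order_on G r" and c: "c \<in> face_chains (Buchberger_faces G) j"
    and cycle: "boundary r c = 0"
  obtains d where "d \<in> face_chains (Buchberger_faces G) (Suc j)" "boundary r d = c"
proof -
  let ?V = "divisors_in G"
  have keys_c: "F \<subseteq> G" "finite F" "card F = Suc j" "\<not> has_proper_divisor G (mlcm F)"
    if "F \<in> Poly_Mapping.keys c" for F
    using that c by (auto simp: face_chains_def Buchberger_faces_def has_proper_divisor_def)
  have sub: "finite F \<and> F \<subseteq> G \<and> mdvd (mlcm F) a" if "F \<subseteq> ?V a" for F a
    using that finite_subset[OF that] ordered_vertices.finite_V[OF ordered_vertices_divisors[OF r]]
    by (auto simp: mlcm_least)
  have bad_iff: "has_proper_divisor (?V a) (mlcm F) \<longleftrightarrow> has_proper_divisor G (mlcm F)"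
    if "F \<subseteq> ?V a" for F a
    using sub[OF that] mdvd_trans by (auto simp: has_proper_divisor_def properly_divides_def)
  define A where "A = {a. \<exists>F. strand a c F \<noteq> 0}"
  have on_c: "chain_on (?V a) (strand a c)" for a using keys_c by (intro chain_on_strand) auto
  have supp: "F \<subseteq> ?V a" "F \<in> Poly_Mapping.keys c" if "strand a c F \<noteq> 0" for a F
    using that on_c[of a] keys_iff_strand[of F c] unfolding chain_on_def by blast+
  let ?fills = "\<lambda>a \<delta>. (\<forall>F. \<delta> F \<noteq> 0 \<longrightarrow> F \<subseteq> ?V a \<and> card F = Suc (Suc j) \<and> \<not> has_proper_divisor (?V a) (mlcm F))
      \<and> simplicial_boundary r (?V a) \<delta> = strand a c"
  have "\<exists>\<delta>. ?fills a \<delta>" if "a \<in> A" for a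
  proof (rule cycle_is_boundary_without_proper_divisors)
    show V: "ordered_vertices (?V a) r" by (rule ordered_vertices_divisors[OF r])
    show "chain_on (?V a) (strand a c)" by (rule on_c)
    obtain F where F: "strand a c F \<noteq> 0" using \<open>a \<in> A\<close> by (auto simp: A_def)
    then have "F \<subseteq> ?V a" "card F = Suc j"
      by (rule supp) (rule keys_c(3)[OF supp(2)[OF F]])
    then show "?V a \<noteq> {}" by (metis card.empty nat.distinct(1) subset_empty)
    show "card F = Suc j" if "strand a c F \<noteq> 0" for F
      by (rule keys_c(3)[OF supp(2)[OF that]])
    show "\<not> has_proper_divisor (?V a) (mlcm F)" if "strand a c F \<noteq> 0" for F
      using keys_c(4)[OF supp(2)[OF that]] bad_iff[OF supp(1)[OF that]] by simp
    have "simplicial_boundary r (?V a) (strand a c) = strand a (boundary r c)"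
      using keys_c ordered_vertices.finite_V[OF V] on_c by (intro strand_boundary[symmetric]) auto
    then show "simplicial_boundary r (?V a) (strand a c) F = 0" for F
      by (simp add: cycle strand_zero)
  qed
  then have "\<forall>a\<in>A. \<exists>\<delta>. ?fills a \<delta>" by blast
  from bchoice[OF this] obtain \<delta> where "\<forall>a\<in>A. ?fills a (\<delta> a)" by blast
  then have \<delta>: "\<And>a F. a \<in> A \<Longrightarrow> \<delta> a F \<noteq> 0
        \<Longrightarrow> F \<subseteq> ?V a \<and> card F = Suc (Suc j) \<and> \<not> has_proper_divisor (?V a) (mlcm F)"
      "\<And>a. a \<in> A \<Longrightarrow> simplicial_boundary r (?V a) (\<delta> a) = strand a c"
    by blast+
  obtain d :: "('x, 'k) mchain" where d: "\<And>a F. strand a d F = (if a \<in> A then \<delta> a F else 0)"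
  proof (rule chain_with_strands[of A \<delta>])
    show "finite A" unfolding A_def by (rule finite_strand_degrees)
    show "finite {F. \<delta> a F \<noteq> 0}" if "a \<in> A" for a
      by (rule finite_subset[of _ "Pow (?V a)"])
        (use \<delta>(1)[OF that] ordered_vertices.finite_V[OF ordered_vertices_divisors[OF r]] in auto)
    show "mdvd (mlcm F) a" if "a \<in> A" "\<delta> a F \<noteq> 0" for a F using \<delta>(1)[OF that] sub by blast
  qed blast
  have keys_d: "F \<subseteq> G \<and> finite F \<and> card F = Suc (Suc j) \<and> \<not> has_proper_divisor G (mlcm F)"
    if F: "F \<in> Poly_Mapping.keys d" for F
  proof -
    obtain a where "a \<in> A" "\<delta> a F \<noteq> 0" using F d by (auto simp: keys_iff_strand split: if_splits)
    from \<delta>(1)[OF this] show ?thesis using sub bad_iff by blast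
  qed
  show thesis
  proof
    show "d \<in> face_chains (Buchberger_faces G) (Suc j)"
      using keys_d by (auto simp: face_chains_def Buchberger_faces_def has_proper_divisor_def)
    show "boundary r d = c"
    proof (rule strand_eqI)
      fix a F
      have "strand a (boundary r d) F = simplicial_boundary r (?V a) (strand a d) F"
        using keys_d ordered_vertices.finite_V[OF ordered_vertices_divisors[OF r]]
        by (subst strand_boundary[of _ "?V a"]) (auto intro!: chain_on_strand)
      also have "\<dots> = strand a c F"
      proof (cases "a \<in> A")
        case True
        then have "strand a d = \<delta> a" using d by auto
        then show ?thesis using \<delta>(2)[OF True] by simp
      next
        case False
        then have "strand a d = (\<lambda>_. 0)" using d by auto
        then show ?thesis using False by (simp add: simplicial_boundary_zero A_def)
      qed
      finally show "strand a (boundary r d) F = strand a c F" .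
    qed
  qed
qed

section \<open>Linearity, freeness and the augmentation\<close>

lemma boundary_superset:
  assumes "finite K" "Poly_Mapping.keys c \<subseteq> K"
  shows "boundary r c = (\<Sum>F\<in>K. chain_scale (Poly_Mapping.lookup c F) (boundary_gen r F))"
proof -
  interpret module chain_scale by (rule module_chain_scale)
  show ?thesis unfolding boundary_def
    using assms by (intro sum.mono_neutral_left) (auto simp: in_keys_iff)
qed

lemma boundary_add: "boundary r (c + d) = boundary r c + boundary r d"
proof -
  interpret module chain_scale by (rule module_chain_scale)
  let ?K = "Poly_Mapping.keys c \<union> Poly_Mapping.keys d"
  have "finite ?K" by simp
  then show ?thesis
    using boundary_superset[of ?K c r] boundary_superset[of ?K d r]
      boundary_superset[of ?K "c + d" r] Poly_Mapping.keys_add[of c d]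
    by (simp add: lookup_add scale_left_distrib sum.distrib)
qed

lemma keys_chain_scale: "Poly_Mapping.keys (chain_scale p c) \<subseteq> Poly_Mapping.keys c"
  by (auto simp: in_keys_iff lookup_chain_scale)

lemma boundary_scale: "boundary r (chain_scale p c) = chain_scale p (boundary r c)"
proof -
  interpret module chain_scale by (rule module_chain_scale)
  have "boundary r (chain_scale p c)
      = (\<Sum>F\<in>Poly_Mapping.keys c. chain_scale p (chain_scale (Poly_Mapping.lookup c F) (boundary_gen r F)))"
    by (subst boundary_superset[OF _ keys_chain_scale]) (simp_all add: lookup_chain_scale)
  then show ?thesis by (simp add: boundary_def scale_sum_right)
qed

lemma mlcm_singleton: "mlcm {v} = v"
  by (rule poly_mapping_eqI) (simp add: lookup_mlcm)

lemma chain_scale_single: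
  "chain_scale p (Poly_Mapping.single F q) = Poly_Mapping.single F (p * q)"
  by (rule poly_mapping_eqI) (simp add: lookup_chain_scale lookup_single when_def)

text \<open>
  The label of a vertex is the vertex itself and the label of the empty face is 1, so the
  augmentation is the boundary map into the empty face.
\<close>

lemma boundary_eq_augmentation:
  fixes c :: "('x::finite, 'k::comm_ring_1) mchain"
  assumes "c \<in> face_chains \<Delta> 0"
  shows "boundary r c = Poly_Mapping.single {} (augmentation c)"
proof -
  have "chain_scale (Poly_Mapping.lookup c F) (boundary_gen r F)
      = Poly_Mapping.single {} (Poly_Mapping.lookup c F * monomial (the_elem F))"
    if F: "F \<in> Poly_Mapping.keys c" for F
  proof -
    have "card F = 1" using assms F by (auto simp: face_chains_def)
    then obtain v where v: "F = {v}" by (auto simp: card_1_singleton_iff)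
    have no_predecessor: "{w. w = v \<and> w \<noteq> v \<and> (w, v) \<in> r} = {}" by blast
    have "boundary_gen r F = (Poly_Mapping.single {} (monomial v) :: ('x, 'k) mchain)"
      by (simp add: boundary_gen_def v mlcm_singleton mlcm_empty no_predecessor)
    then show ?thesis by (simp add: v chain_scale_single)
  qed
  then have "boundary r c = (\<Sum>F\<in>Poly_Mapping.keys c.
      Poly_Mapping.single {} (Poly_Mapping.lookup c F * monomial (the_elem F)))"
    by (simp add: boundary_def)
  also have "\<dots> = Poly_Mapping.single {} (augmentation c)"
    by (rule poly_mapping_eqI)
      (simp add: augmentation_def lookup_sum lookup_single when_def)
  finally show ?thesis .
qed

lemma face_chains_add: "c \<in> face_chains \<Delta> i \<Longrightarrow> d \<in> face_chains \<Delta> i \<Longrightarrow> c + d \<in> face_chains \<Delta> i"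
  using Poly_Mapping.keys_add[of c d] by (fastforce simp: face_chains_def)

lemma face_chains_scale: "c \<in> face_chains \<Delta> i \<Longrightarrow> chain_scale p c \<in> face_chains \<Delta> i"
  using keys_chain_scale[of p c] by (auto simp: face_chains_def)

lemma linear_augmentation:
  fixes \<Delta> :: "'x::finite mon set set"
  shows "linear_map_on chain_scale (*) (face_chains \<Delta> 0)
    (augmentation :: ('x, 'k::comm_ring_1) mchain \<Rightarrow> _)"
proof -
  \<comment> \<open>No vertex precedes itself, so all relations give the same boundary here.\<close>
  have *: "augmentation c = Poly_Mapping.lookup (boundary {} c) {}" if "c \<in> face_chains \<Delta> 0"
    for c :: "('x, 'k) mchain"
    using boundary_eq_augmentation[OF that, of "{}"] by simp
  show ?thesis
    unfolding linear_map_on_def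
    by (simp add: * face_chains_add face_chains_scale boundary_add boundary_scale lookup_add
        lookup_chain_scale)
qed

lemma free_face_chains:
  "free_module chain_scale (face_chains \<Delta> i :: ('x::finite, 'k::comm_ring_1) mchain set)"
proof -
  interpret module "chain_scale :: ('x, 'k) mpol \<Rightarrow> _" by (rule module_chain_scale)
  let ?X = "{F \<in> \<Delta>. finite F \<and> card F = Suc i}"
  let ?e = "\<lambda>F. Poly_Mapping.single F 1 :: ('x, 'k) mchain"
  have inj: "inj_on ?e A" for A by (rule inj_onI) (metis keys_single one_neq_zero singleton_inject)
  have "independent (?e ` ?X)"
  proof
    assume "dependent (?e ` ?X)"
    then obtain t u where t: "finite t" "t \<subseteq> ?e ` ?X" "(\<Sum>v\<in>t. chain_scale (u v) v) = 0"
        "\<exists>v\<in>t. u v \<noteq> 0" by (auto simp: dependent_explicit)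
    obtain Y where Y: "Y \<subseteq> ?X" "t = ?e ` Y" using t(2) by (auto simp: subset_image_iff)
    have "finite Y" using t(1) Y(2) inj finite_image_iff by blast
    have "u (?e E) = 0" if "E \<in> Y" for E
    proof -
      have "0 = Poly_Mapping.lookup (\<Sum>F\<in>Y. chain_scale (u (?e F)) (?e F)) E"
        using t(3) by (simp add: Y(2) sum.reindex[OF inj])
      also have "\<dots> = u (?e E)"
        using \<open>finite Y\<close> that by (simp add: lookup_sum chain_scale_single lookup_single when_def)
      finally show ?thesis by simp
    qed
    then show False using t(4) Y(2) by blast
  qed
  moreover have "span (?e ` ?X) = face_chains \<Delta> i"
  proof
    have "subspace (face_chains \<Delta> i :: ('x, 'k) mchain set)"
      by (rule subspaceI) (auto simp: face_chains_add face_chains_scale, simp add: face_chains_def)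
    then show "span (?e ` ?X) \<subseteq> face_chains \<Delta> i"
      by (rule span_minimal[rotated]) (auto simp: face_chains_def)
    show "face_chains \<Delta> i \<subseteq> span (?e ` ?X)"
    proof
      fix c :: "('x, 'k) mchain" assume c: "c \<in> face_chains \<Delta> i"
      have "(\<Sum>F\<in>Poly_Mapping.keys c. chain_scale (Poly_Mapping.lookup c F) (?e F)) \<in> span (?e ` ?X)"
        using c by (intro span_sum span_scale span_base) (auto simp: face_chains_def)
      then show "c \<in> span (?e ` ?X)"
        using poly_mapping_sum_single[of c] by (simp add: chain_scale_single)
    qed
  qed
  ultimately show ?thesis unfolding free_module_def by blast
qed

lemma augmentation_onto:
  fixes G :: "'x::finite mon set"
  assumes "\<And>v. v \<in> G \<Longrightarrow> {v} \<in> \<Delta>" "\<And>F. F \<in> \<Delta> \<Longrightarrow> F \<subseteq> G"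
  shows "augmentation ` face_chains \<Delta> 0 = (ideal_span (monomial ` G) :: ('x, 'k::comm_ring_1) mpol set)"
proof -
  interpret module "(*) :: ('x, 'k) mpol \<Rightarrow> ('x, 'k) mpol \<Rightarrow> ('x, 'k) mpol"
    by (rule module_times)
  note lin = linear_augmentation[of \<Delta>, where 'k = 'k, unfolded linear_map_on_def]
  show ?thesis
  proof
    have "augmentation c \<in> span (monomial ` G)" if c: "c \<in> face_chains \<Delta> 0" for c :: "('x, 'k) mchain"
      unfolding augmentation_def
    proof (intro span_sum span_scale span_base imageI)
      fix F assume "F \<in> Poly_Mapping.keys c"
      then have "F \<in> \<Delta>" "card F = 1" using c by (auto simp: face_chains_def)
      then show "the_elem F \<in> G" using assms(2)[of F] by (auto simp: card_1_singleton_iff)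
    qed
    then show "augmentation ` face_chains \<Delta> 0 \<subseteq> span (monomial ` G :: ('x, 'k) mpol set)" by blast
    show "span (monomial ` G) \<subseteq> augmentation ` (face_chains \<Delta> 0 :: ('x, 'k) mchain set)"
    proof (rule span_minimal)
      show "monomial ` G \<subseteq> augmentation ` (face_chains \<Delta> 0 :: ('x, 'k) mchain set)"
      proof
        fix p :: "('x, 'k) mpol" assume "p \<in> monomial ` G"
        then obtain v where v: "v \<in> G" "p = monomial v" by blast
        let ?c = "Poly_Mapping.single {v} 1 :: ('x, 'k) mchain"
        have "?c \<in> face_chains \<Delta> 0" using assms(1) v by (simp add: face_chains_def)
        moreover have "augmentation ?c = p" by (simp add: augmentation_def v)
        ultimately show "p \<in> augmentation ` (face_chains \<Delta> 0 :: ('x, 'k) mchain set)" by blast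
      qed
      show "subspace (augmentation ` (face_chains \<Delta> 0 :: ('x, 'k) mchain set))"
      proof (rule subspaceI)
        have "(0 :: ('x, 'k) mchain) \<in> face_chains \<Delta> 0" by (simp add: face_chains_def)
        then show "0 \<in> augmentation ` (face_chains \<Delta> 0 :: ('x, 'k) mchain set)"
          by (rule rev_image_eqI) (simp add: augmentation_def)
      next
        fix p q :: "('x, 'k) mpol"
        assume "p \<in> augmentation ` (face_chains \<Delta> 0 :: ('x, 'k) mchain set)"
          "q \<in> augmentation ` (face_chains \<Delta> 0 :: ('x, 'k) mchain set)"
        then obtain c d :: "('x, 'k) mchain"
          where cd: "c \<in> face_chains \<Delta> 0" "d \<in> face_chains \<Delta> 0"
            and pq: "p = augmentation c" "q = augmentation d" by blast
        have "p + q = augmentation (c + d)" using lin cd pq by simp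
        then show "p + q \<in> augmentation ` (face_chains \<Delta> 0 :: ('x, 'k) mchain set)"
          using face_chains_add[OF cd] by blast
      next
        fix p q :: "('x, 'k) mpol"
        assume "q \<in> augmentation ` (face_chains \<Delta> 0 :: ('x, 'k) mchain set)"
        then obtain c :: "('x, 'k) mchain"
          where c: "c \<in> face_chains \<Delta> 0" and q: "q = augmentation c" by blast
        have "p * q = augmentation (chain_scale p c)" using lin c q by simp
        then show "p * q \<in> augmentation ` (face_chains \<Delta> 0 :: ('x, 'k) mchain set)"
          using face_chains_scale[OF c] by blast
      qed
    qed
  qed
qed

section \<open>The resolution\<close>

text \<open>
  A vertex \<open>v\<close> could only be properly divided by itself, by minimality, and a monomial properly
  divides itself only if it is 1.
\<close>

lemma simplicial_complex_Buchberger_faces: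
  fixes G :: "'x::finite mon set"
  assumes "0 \<notin> G" and min: "\<And>u v. u \<in> G \<Longrightarrow> v \<in> G \<Longrightarrow> mdvd u v \<Longrightarrow> u = v"
  shows "simplicial_complex G (Buchberger_faces G)"
proof -
  have "{v} \<in> Buchberger_faces G" if v: "v \<in> G" for v
  proof -
    have "\<not> properly_divides u v" if u: "u \<in> G" for u
    proof
      assume p: "properly_divides u v"
      then have "u = v" using min u v by (simp add: properly_divides_def)
      then have "v = 0" using p by (intro poly_mapping_eqI) (auto simp: properly_divides_def)
      then show False using v \<open>0 \<notin> G\<close> by simp
    qed
    then show ?thesis using v by (simp add: Buchberger_faces_def mlcm_singleton)
  qed
  moreover have "E \<in> Buchberger_faces G" if F: "F \<in> Buchberger_faces G" and "E \<subseteq> F" for E F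
  proof -
    have "finite F" "F \<subseteq> G" using F by (simp_all add: Buchberger_faces_def)
    moreover have "\<not> properly_divides u (mlcm E)" if "u \<in> G" for u
      using F that properly_divides_mono[OF _ mlcm_mono[OF \<open>finite F\<close> \<open>E \<subseteq> F\<close>], of u]
      by (auto simp: Buchberger_faces_def)
    ultimately show ?thesis
      using \<open>E \<subseteq> F\<close> finite_subset[of E F] by (simp add: Buchberger_faces_def)
  qed
  moreover have "finite F \<and> F \<subseteq> G" if "F \<in> Buchberger_faces G" for F
    using that by (simp add: Buchberger_faces_def)
  ultimately show ?thesis unfolding simplicial_complex_def by blast
qed

lemma boundary_face_chains:
  assumes "simplicial_complex G \<Delta>" "c \<in> face_chains \<Delta> (Suc i)"
  shows "boundary r c \<in> face_chains \<Delta> i"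
proof -
  have "F \<in> \<Delta> \<and> finite F \<and> card F = Suc i" if F: "F \<in> Poly_Mapping.keys (boundary r c)" for F
  proof -
    have "\<forall>F\<in>Poly_Mapping.keys c. finite F" using assms(2) by (auto simp: face_chains_def)
    from this F obtain v where "v \<notin> F" "insert v F \<in> Poly_Mapping.keys c" by (rule keys_boundary)
    then have "v \<notin> F" "insert v F \<in> \<Delta>" "finite (insert v F)" "card (insert v F) = Suc (Suc i)"
      using assms(2) by (auto simp: face_chains_def)
    then show ?thesis using assms(1) unfolding simplicial_complex_def by (auto simp: subset_insertI)
  qed
  then show ?thesis by (auto simp: face_chains_def)
qed

lemma free_resolution_Buchberger_faces:
  fixes G :: "'x::finite mon set"
  assumes r: "linear_order_on G r" and \<Delta>: "simplicial_complex G (Buchberger_faces G)"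
  shows "free_resolution chain_scale (*) (face_chains (Buchberger_faces G)) (\<lambda>_. boundary r)
    augmentation (ideal_span (monomial ` G) :: ('x, 'k::comm_ring_1) mpol set)"
proof -
  let ?C = "face_chains (Buchberger_faces G) :: nat \<Rightarrow> ('x, 'k) mchain set"
  have keys: "finite F \<and> F \<subseteq> G" if "F \<in> Poly_Mapping.keys c" "c \<in> ?C i" for F c i
    using that by (auto simp: face_chains_def Buchberger_faces_def)
  have exact: "boundary r ` ?C (Suc i) = {c \<in> ?C i. boundary r c = 0}" for i
  proof (intro equalityI subsetI)
    fix c assume "c \<in> boundary r ` ?C (Suc i)"
    then obtain d where "d \<in> ?C (Suc i)" "c = boundary r d" by blast
    then show "c \<in> {c \<in> ?C i. boundary r c = 0}"
      using boundary_face_chains[OF \<Delta>] boundary_boundary_chain[OF r, of d] keys by blast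
  next
    fix c assume "c \<in> {c \<in> ?C i. boundary r c = 0}"
    then show "c \<in> boundary r ` ?C (Suc i)" using cycle_is_boundary[OF r, of c i] by blast
  qed
  have "augmentation c = 0 \<longleftrightarrow> boundary r c = 0" if "c \<in> ?C 0" for c
    using boundary_eq_augmentation[OF that, of r] by (metis lookup_single_eq lookup_zero single_zero)
  then have exact_0: "boundary r ` ?C 1 = {c \<in> ?C 0. augmentation c = 0}" using exact[of 0] by auto
  have onto: "augmentation ` ?C 0 = ideal_span (monomial ` G)"
    using \<Delta> by (intro augmentation_onto) (auto simp: simplicial_complex_def)
  have linear_boundary: "linear_map_on chain_scale chain_scale (?C i) (boundary r)" for i
    by (simp add: linear_map_on_def boundary_add boundary_scale)
  show ?thesis
    unfolding free_resolution_def
    by (intro conjI allI module_chain_scale module_times free_face_chains linear_boundary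
        linear_augmentation onto exact_0 exact)
qed

theorem theorem1p12:
  fixes I :: "('x::finite, 'k::field) mpol set"
    and r :: "('x mon \<times> 'x mon) set"
  assumes "monomial_ideal I"
    and "I \<noteq> UNIV"
    and "linear_order_on (min_gens I) r"
  shows "supports_free_resolution r (Buchberger_complex I) I"
proof -
  interpret module "(*) :: ('x, 'k) mpol \<Rightarrow> ('x, 'k) mpol \<Rightarrow> ('x, 'k) mpol"
    by (rule module_times)
  define G where "G = min_gens I"
  note G_eq = min_gens_eq[OF assms(1), folded G_def]
  have "minimal_generating_set G I"
    using minimal_generating_set_iff[OF assms(1)] G_eq by blast
  then have gen: "ideal_span (monomial ` G) = I" by (simp add: minimal_generating_set_def)
  have "0 \<notin> G"
  proof
    assume "0 \<in> G"
    then have one: "1 \<in> I" by (simp add: G_eq monomial_def)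
    have "p \<in> I" for p using span_scale[of 1 "monomial ` G" p] one by (simp add: gen)
    then show False using \<open>I \<noteq> UNIV\<close> by blast
  qed
  moreover have "u = v" if "u \<in> G" "v \<in> G" "mdvd u v" for u v using that by (auto simp: G_eq)
  ultimately have \<Delta>: "simplicial_complex G (Buchberger_faces G)"
    by (rule simplicial_complex_Buchberger_faces)
  have "Buchberger_complex I = Buchberger_faces G"
    by (simp add: Buchberger_complex_def Buchberger_faces_def G_def)
  then show ?thesis
    unfolding supports_free_resolution_def
    using \<Delta> free_resolution_Buchberger_faces[OF assms(3)[folded G_def] \<Delta>, where 'k = 'k]
    by (simp add: gen flip: G_def)
qed

end
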